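(* Let $n_1\ge 2$ and $n_2\ge 1$ be integers, let $e$ be an edge of the complete bipartite graph $K_{n_1,n_2}$ with parts $V_{n_1}$ and $V_{n_2}$ of sizes $n_1$ and $n_2$, and let $e_1$ be an edge joining the endpoint of $e$ in $V_{n_1}$ to another vertex of $V_{n_1}$. Then \begin{align*} a(K_{n_1,n_2}+e_1)&=a(K_{n_1,n_2})+a(K_{n_1-1,n_2}),\\ a(K_{n_1,n_2}+e_1-e)&=a(K_{n_1,n_2}-e)+a(K_{n_1-1,n_2}),\\ a(K_{n_1,n_2})&=a(K_{n_1,n_2}-e)+a(K_{n_1-1,n_2-1,1}). \end{align*}
   Context: An acyclic orientation of a graph $G$ is an assignment of a direction to each edge of $G$ such that the resulting directed graph has no directed cycles; $a(G)$ denotes the number of acyclic orientations of $G$. For a graph $G$, $G-e$ denotes $G$ with the edge $e$ deleted and $G+e_1$ denotes $G$ with the new edge $e_1$ added (same vertex set). $K_{m_1,\dots,m_r}$ is the complete $r$-partite graph with parts of sizes $m_1,\dots,m_r$: all edges between different parts and none within a part (a part of size $0$ is simply omitted). *)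

theory Defs
  imports Main
begin

record 'a ugraph =
  vertices :: "'a set"
  edges :: "'a set set"

definition simple_graph :: "'a ugraph \<Rightarrow> bool" where
  "simple_graph G \<longleftrightarrow> finite (vertices G) \<and> (\<forall>e \<in> edges G. e \<subseteq> vertices G \<and> card e = 2)"

definition delete_edge :: "'a ugraph \<Rightarrow> 'a set \<Rightarrow> 'a ugraph" where
  "delete_edge G e = G\<lparr>edges := edges G - {e}\<rparr>"

definition add_edge :: "'a ugraph \<Rightarrow> 'a set \<Rightarrow> 'a ugraph" where
  "add_edge G e = G\<lparr>edges := insert e (edges G)\<rparr>"

text \<open>An orientation is given by its set of arcs: forgetting directions matches the arcs
  one-to-one with the edges, so each edge \<open>{x, y}\<close> receives exactly one of the directions
  \<open>(x, y)\<close> and \<open>(y, x)\<close>, and there are no other arcs.\<close>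

definition orientation :: "'a ugraph \<Rightarrow> 'a rel \<Rightarrow> bool" where
  "orientation G D \<longleftrightarrow> bij_betw (\<lambda>(x, y). {x, y}) D (edges G)"

definition num_acyclic_orientations :: "'a ugraph \<Rightarrow> nat" where
  "num_acyclic_orientations G = card {D. orientation G D \<and> acyclic D}"

text \<open>The parts are meant to be pairwise disjoint; the list may contain empty parts, which
  contribute neither vertices nor edges.\<close>

definition complete_multipartite_on :: "'a set list \<Rightarrow> 'a ugraph" where
  "complete_multipartite_on Vs =
    \<lparr>vertices = \<Union> (set Vs),
     edges = {{x, y} | x y i j. i < length Vs \<and> j < length Vs \<and> i \<noteq> j \<and> x \<in> Vs ! i \<and> y \<in> Vs ! j}\<rparr>"

text \<open>The graph \<open>K\<close> with part sizes \<open>m\<^sub>1, \<dots>, m\<^sub>r\<close>, on concrete vertices: part \<open>i\<close> consists of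
  the pairs \<open>(i, k)\<close> with \<open>k < m\<^sub>i\<close> (indices starting at \<open>0\<close>).\<close>

definition complete_multipartite :: "nat list \<Rightarrow> (nat \<times> nat) ugraph" where
  "complete_multipartite ms =
    complete_multipartite_on (map (\<lambda>i. {i} \<times> {..<ms ! i}) [0..<length ms])"

lemma simple_graph_complete_multipartite_on:
  assumes "\<And>V. V \<in> set Vs \<Longrightarrow> finite V"
    and "\<And>i j. i < length Vs \<Longrightarrow> j < length Vs \<Longrightarrow> i \<noteq> j \<Longrightarrow> Vs ! i \<inter> Vs ! j = {}"
  shows "simple_graph (complete_multipartite_on Vs)"
proof -
  have "{x, y} \<subseteq> \<Union> (set Vs) \<and> card {x, y} = 2"
    if "i < length Vs" "j < length Vs" "i \<noteq> j" "x \<in> Vs ! i" "y \<in> Vs ! j" for x y i j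
  proof -
    have "x \<noteq> y" using assms(2)[of i j] that by auto
    then show ?thesis using that nth_mem[of i Vs] nth_mem[of j Vs] by auto
  qed
  then show ?thesis
    unfolding simple_graph_def complete_multipartite_on_def using assms(1) by auto
qed

lemma simple_graph_complete_multipartite: "simple_graph (complete_multipartite ms)"
  unfolding complete_multipartite_def
  by (rule simple_graph_complete_multipartite_on) auto

lemma orientation_iff:
  assumes "simple_graph G"
  shows "orientation G D \<longleftrightarrow>
    (\<forall>(x, y) \<in> D. {x, y} \<in> edges G) \<and>
    (\<forall>x y. {x, y} \<in> edges G \<longrightarrow> ((x, y) \<in> D \<longleftrightarrow> (y, x) \<notin> D))"
    (is "?L \<longleftrightarrow> ?R")
proof
  have neq: "x \<noteq> y" if "{x, y} \<in> edges G" for x y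
    using assms that unfolding simple_graph_def by fastforce
  show ?R if ?L
  proof -
    from that have inj: "inj_on (\<lambda>(x, y). {x, y}) D"
      and img: "(\<lambda>(x, y). {x, y}) ` D = edges G"
      unfolding orientation_def bij_betw_def by auto
    have "(x, y) \<in> D \<longleftrightarrow> (y, x) \<notin> D" if e: "{x, y} \<in> edges G" for x y
    proof -
      have "{x, y} \<in> (\<lambda>(x, y). {x, y}) ` D" using e img by simp
      then obtain a b where "(a, b) \<in> D" "{x, y} = {a, b}" by auto
      then have "(x, y) \<in> D \<or> (y, x) \<in> D" by (auto simp: doubleton_eq_iff)
      moreover have "\<not> ((x, y) \<in> D \<and> (y, x) \<in> D)"
        using inj_onD[OF inj, of "(x, y)" "(y, x)"] neq[OF e] by (auto simp: insert_commute)
      ultimately show ?thesis by blast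
    qed
    then show ?thesis using img by auto
  qed
  show ?L if r: ?R
  proof -
    have "inj_on (\<lambda>(x, y). {x, y}) D"
      using r by (auto simp: inj_on_def doubleton_eq_iff)
    moreover have "(\<lambda>(x, y). {x, y}) ` D = edges G"
    proof
      show "(\<lambda>(x, y). {x, y}) ` D \<subseteq> edges G" using r by auto
      show "edges G \<subseteq> (\<lambda>(x, y). {x, y}) ` D"
      proof
        fix e assume e: "e \<in> edges G"
        then have "card e = 2" using assms unfolding simple_graph_def by blast
        then obtain x y where xy: "e = {x, y}" by (auto simp: card_2_iff)
        then have "(x, y) \<in> D \<or> (y, x) \<in> D" using e r by blast
        then show "e \<in> (\<lambda>(x, y). {x, y}) ` D"
          using xy by (auto simp: image_iff insert_commute intro: bexI[rotated])
      qed
    qed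
    ultimately show ?thesis unfolding orientation_def bij_betw_def by blast
  qed
qed

end

theory Submission
  imports Defs
begin

text \<open>Each identity is an instance of deletion--contraction, \<open>a(G + uw) = a(G) + a(G/uw)\<close> for
  nonadjacent vertices \<open>u \<noteq> w\<close>. An acyclic orientation \<open>D\<close> of \<open>G\<close> extends by the arc \<open>(u, w)\<close>
  unless \<open>D\<close> has a path from \<open>w\<close> to \<open>u\<close>, and by \<open>(w, u)\<close> unless it has a path from \<open>u\<close> to \<open>w\<close>.
  Since \<open>D\<close> cannot have both paths, at least one extension is possible, and both are possible
  exactly if \<open>D\<close> has no path between \<open>u\<close> and \<open>w\<close> in either direction. Hence \<open>a(G + uw) - a(G)\<close>
  counts the orientations of the latter kind, and these are precisely the ones that stay acyclic
  when \<open>u\<close> and \<open>w\<close> are identified, that is, the acyclic orientations of the contraction.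

  The three contractions are complete multipartite. Identifying two vertices of the same part of
  \<open>K\<close> gives a bipartite graph with one vertex less in that part; this remains so if one edge at
  \<open>u\<close> was removed before, because the parallel edge at \<open>w\<close> survives. Identifying the ends of an
  edge of \<open>K\<close> gives a vertex adjacent to all others, which becomes a part of size one.

  The contraction is described by a vertex map \<open>f\<close> whose only nontrivial fibre is \<open>{u, w}\<close>.
  Its target may be any vertex type, so the relabelling of the contracted graph
  as a graph on the concrete vertex set of \<^const>\<open>complete_multipartite\<close> needs no separate
  isomorphism argument.\<close>

section \<open>Orientations under vertex maps\<close>

lemma orientation_subset_vertices:
  assumes "simple_graph G" and "orientation G D"
  shows "D \<subseteq> vertices G \<times> vertices G"
  using assms unfolding orientation_iff[OF assms(1)] simple_graph_def by fastforce

lemma orientation_arcD: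
  assumes "orientation G D" and "(x, y) \<in> D"
  shows "{x, y} \<in> edges G"
  using bij_betwE[OF assms(1)[unfolded orientation_def]] assms(2) by fastforce

lemma finite_orientations:
  assumes "simple_graph G"
  shows "finite {D. orientation G D}"
proof (rule finite_subset)
  show "{D. orientation G D} \<subseteq> Pow (vertices G \<times> vertices G)"
    using orientation_subset_vertices[OF assms] by blast
  show "finite (Pow (vertices G \<times> vertices G))"
    using assms by (simp add: simple_graph_def)
qed

text \<open>Several edges of \<open>G\<close> may have the same image, so an orientation of \<open>G\<close> can orient an edge of
  the image graph both ways. Acyclicity of the image rules this out: all edges over one edge
  then point the same way, and the orientation can be recovered from its image.\<close>

lemma bij_betw_map_orientation:
  assumes G: "simple_graph G" and G': "simple_graph G'"
    and edges: "edges G' = (`) f ` edges G"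
  shows "bij_betw ((`) (map_prod f f))
    {D. orientation G D \<and> acyclic (map_prod f f ` D)}
    {D'. orientation G' D' \<and> acyclic D'}"
    (is "bij_betw ?F ?A ?B")
proof -
  have edge': "{f x, f y} \<in> edges G'" if "{x, y} \<in> edges G" for x y
    using imageI[OF that, of "(`) f"] edges by simp
  have no_2cycle: "(q, p) \<notin> R" if "acyclic R" "(p, q) \<in> R" for p q and R :: "'b rel"
    using that by (meson acyclic_def r_into_trancl trancl_into_trancl)
  have "inj_on ?F ?A"
  proof (rule inj_onI)
    have sub: "D \<subseteq> D2"
      if "D \<in> ?A" "D2 \<in> ?A" "?F D = ?F D2" for D D2
    proof (clarify, rule ccontr)
      fix x y assume xy: "(x, y) \<in> D" and not: "(x, y) \<notin> D2"
      have "{x, y} \<in> edges G" using that(1) xy by (auto dest: orientation_arcD)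
      then have "(y, x) \<in> D2" using that(2) not by (auto simp: orientation_iff[OF G])
      then have "(f y, f x) \<in> ?F D2" by force
      moreover have "(f x, f y) \<in> ?F D2" unfolding that(3)[symmetric] using xy by force
      moreover have "acyclic (?F D2)" using that(2) by simp
      ultimately show False using no_2cycle by metis
    qed
    show "D = D2" if "D \<in> ?A" "D2 \<in> ?A" "?F D = ?F D2" for D D2
      using sub[OF that] sub[OF that(2,1) that(3)[symmetric]] by blast
  qed
  moreover have "?F ` ?A = ?B"
  proof
    show "?F ` ?A \<subseteq> ?B"
    proof clarify
      fix D assume D: "orientation G D" and ac: "acyclic (?F D)"
      have exact: "(p, q) \<in> ?F D \<longleftrightarrow> (q, p) \<notin> ?F D" if "{p, q} \<in> edges G'" for p q
      proof -
        obtain e where e: "e \<in> edges G" "{p, q} = f ` e" using \<open>{p, q} \<in> edges G'\<close> edges by auto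
        then obtain x y where xy: "e = {x, y}"
          using G by (auto simp: simple_graph_def card_2_iff)
        have "(x, y) \<in> D \<or> (y, x) \<in> D" using D e xy by (auto simp: orientation_iff[OF G])
        then have "(f x, f y) \<in> ?F D \<or> (f y, f x) \<in> ?F D" by force
        moreover have "{p, q} = {f x, f y}" using e xy by simp
        ultimately have "(p, q) \<in> ?F D \<or> (q, p) \<in> ?F D" by (auto simp: doubleton_eq_iff)
        then show ?thesis using no_2cycle[OF ac] by metis
      qed
      have "\<forall>(p, q) \<in> ?F D. {p, q} \<in> edges G'"
        using edge' orientation_arcD[OF D] by auto
      then show "orientation G' (?F D)" using exact by (simp add: orientation_iff[OF G'])
    qed
    show "?B \<subseteq> ?F ` ?A"
    proof clarify
      fix D' assume D': "orientation G' D'" and ac: "acyclic D'"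
      \<comment> \<open>Every edge of \<open>G\<close> is oriented as the edge below it.\<close>
      define D where "D = {(x, y). {x, y} \<in> edges G \<and> (f x, f y) \<in> D'}"
      have "(x, y) \<in> D \<longleftrightarrow> (y, x) \<notin> D" if xy: "{x, y} \<in> edges G" for x y
      proof -
        have "{y, x} \<in> edges G" using xy by (simp add: insert_commute)
        then show ?thesis
          using xy edge'[OF xy] D' by (simp add: D_def orientation_iff[OF G'])
      qed
      then have "orientation G D" by (simp add: orientation_iff[OF G] D_def)
      moreover have "?F D = D'"
      proof
        show "?F D \<subseteq> D'" by (auto simp: D_def)
        show "D' \<subseteq> ?F D"
        proof clarify
          fix p q assume pq: "(p, q) \<in> D'"
          then have "{p, q} \<in> edges G'" by (rule orientation_arcD[OF D'])
          then obtain e where e: "e \<in> edges G" "{p, q} = f ` e" using edges by auto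
          then obtain x y where xy: "e = {x, y}"
            using G by (auto simp: simple_graph_def card_2_iff)
          then have "{p, q} = {f x, f y}" using e(2) by simp
          then obtain a b where ab: "{a, b} \<in> edges G" "p = f a" "q = f b"
            using e(1) xy by (metis doubleton_eq_iff insert_commute)
          then have "(a, b) \<in> D" using pq by (simp add: D_def)
          then show "(p, q) \<in> ?F D" using ab by force
        qed
      qed
      ultimately show "D' \<in> ?F ` ?A" using ac by blast
    qed
  qed
  ultimately show ?thesis by (simp add: bij_betw_def)
qed

section \<open>Deletion--contraction\<close>

text \<open>A walk in the image lifts to a path of \<open>D\<close>, except that it may jump between \<open>u\<close> and \<open>w\<close>.
  Between two jumps there is a nonempty path of \<open>D\<close> from \<open>{u, w}\<close> to itself, which the right-hand
  side excludes, so one jump at most is possible. If the walk is closed, the lifted path or its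
  pieces again yield a nonempty path of \<open>D\<close> from \<open>{u, w}\<close> to itself, or a cycle of \<open>D\<close>.\<close>

lemma acyclic_identify_iff:
  assumes D: "D \<subseteq> V \<times> V" and eq: "f u = f w"
    and fibre: "\<And>x y. x \<in> V \<Longrightarrow> y \<in> V \<Longrightarrow> f x = f y \<Longrightarrow> x = y \<or> x \<in> {u, w} \<and> y \<in> {u, w}"
  shows "acyclic (map_prod f f ` D) \<longleftrightarrow> acyclic D \<and> (u, w) \<notin> D\<^sup>+ \<and> (w, u) \<notin> D\<^sup>+"
    (is "acyclic ?D' \<longleftrightarrow> _")
proof
  assume ac: "acyclic ?D'"
  have map: "(f x, f y) \<in> ?D'\<^sup>+" if "(x, y) \<in> D\<^sup>+" for x y
    using that
  proof induction
    case (base y)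
    then show ?case by (force intro: r_into_trancl)
  next
    case (step y z)
    then have "(f y, f z) \<in> ?D'" by force
    then show ?case using step.IH by (rule trancl_into_trancl[rotated])
  qed
  show "acyclic D \<and> (u, w) \<notin> D\<^sup>+ \<and> (w, u) \<notin> D\<^sup>+"
    using ac map eq by (metis acyclic_def)
next
  assume "acyclic D \<and> (u, w) \<notin> D\<^sup>+ \<and> (w, u) \<notin> D\<^sup>+"
  then have irr: "(x, x) \<notin> D\<^sup>+" and sep: "s \<in> {u, w} \<Longrightarrow> t \<in> {u, w} \<Longrightarrow> (s, t) \<notin> D\<^sup>+"
    for x s t by (auto simp: acyclic_def)
  have V: "x \<in> V \<and> y \<in> V" if "(x, y) \<in> D\<^sup>+" for x y
    using trancl_subset_Sigma[OF D] that by blast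
  have lift: "\<exists>x y. f x = p \<and> f y = q \<and>
      ((x, y) \<in> D\<^sup>+ \<or> (\<exists>s\<in>{u, w}. \<exists>t\<in>{u, w}. (x, s) \<in> D\<^sup>+ \<and> (t, y) \<in> D\<^sup>+))"
    if "(p, q) \<in> ?D'\<^sup>+" for p q
    using that
  proof induction
    case (base q)
    then show ?case by (auto intro: r_into_trancl)
  next
    case (step q r)
    from step.hyps(2) obtain y' z where z: "(y', z) \<in> D" "q = f y'" "r = f z" by auto
    from step.IH obtain x y where xy: "f x = p" "f y = q" and path:
      "(x, y) \<in> D\<^sup>+ \<or> (\<exists>s\<in>{u, w}. \<exists>t\<in>{u, w}. (x, s) \<in> D\<^sup>+ \<and> (t, y) \<in> D\<^sup>+)" by blast
    have "y \<in> V" "y' \<in> V" using path V z(1) D by blast+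
    then consider "y = y'" | "y \<in> {u, w}" "y' \<in> {u, w}" using fibre xy z by metis
    then have "(x, z) \<in> D\<^sup>+ \<or> (\<exists>s\<in>{u, w}. \<exists>t\<in>{u, w}. (x, s) \<in> D\<^sup>+ \<and> (t, z) \<in> D\<^sup>+)"
    proof cases
      case 1
      then show ?thesis using path z(1) by (meson trancl_into_trancl)
    next
      case 2
      then have "(x, y) \<in> D\<^sup>+" using path sep by blast
      then show ?thesis using 2 z(1) by blast
    qed
    then show ?case using xy(1) z(3) by blast
  qed
  show "acyclic ?D'"
    unfolding acyclic_def
  proof clarify
    fix p assume "(p, p) \<in> ?D'\<^sup>+"
    from lift[OF this] obtain x y where xy: "f x = f y" and path:
      "(x, y) \<in> D\<^sup>+ \<or> (\<exists>s\<in>{u, w}. \<exists>t\<in>{u, w}. (x, s) \<in> D\<^sup>+ \<and> (t, y) \<in> D\<^sup>+)" by metis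
    have "x \<in> V" "y \<in> V" using path V by blast+
    then consider "x = y" | "x \<in> {u, w}" "y \<in> {u, w}" using fibre xy by metis
    then show False
    proof cases
      case 1
      then show False using path irr sep by (meson trancl_trans)
    next
      case 2
      then show False using path sep by blast
    qed
  qed
qed

lemma orientation_add_edge_iff:
  assumes new: "{u, w} \<notin> edges G"
  shows "orientation (add_edge G {u, w}) D \<longleftrightarrow>
    (\<exists>D0. orientation G D0 \<and> (D = insert (u, w) D0 \<or> D = insert (w, u) D0))"
    (is "?L \<longleftrightarrow> ?R")
proof
  let ?\<phi> = "\<lambda>(x, y). {x, y}"
  have ext: "bij_betw ?\<phi> (insert d D0) (insert {u, w} (edges G)) \<longleftrightarrow> bij_betw ?\<phi> D0 (edges G)"
    if "?\<phi> d = {u, w}" "d \<notin> D0" for d D0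
    using notIn_Un_bij_betw3[of d D0 ?\<phi> "edges G"] that new by simp
  show ?L if ?R
  proof -
    obtain d D0 where D0: "orientation G D0" and "d = (u, w) \<or> d = (w, u)" and D: "D = insert d D0"
      using \<open>?R\<close> by blast
    then have d: "?\<phi> d = {u, w}" by auto
    have "d \<notin> D0"
      using D0 d new unfolding orientation_def by (metis bij_betwE)
    then show ?thesis
      using D0 ext[OF d] by (simp add: D orientation_def add_edge_def)
  qed
  show ?R if ?L
  proof -
    have bij: "bij_betw ?\<phi> D (insert {u, w} (edges G))"
      using that by (simp add: orientation_def add_edge_def)
    then have "{u, w} \<in> ?\<phi> ` D" by (simp add: bij_betw_def)
    then obtain d where d: "d \<in> D" "?\<phi> d = {u, w}" by (elim imageE) simp
    then have "orientation G (D - {d})"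
      using bij ext[of d "D - {d}"] by (simp add: orientation_def insert_absorb)
    moreover have "d = (u, w) \<or> d = (w, u)"
      using d(2) by (cases d) (simp add: doubleton_eq_iff)
    ultimately show ?thesis using d(1) by (metis insert_Diff)
  qed
qed

text \<open>The vertex map \<open>f\<close> exhibits \<open>G'\<close> as the contraction of \<open>u\<close> and \<open>w\<close> in \<open>G\<close>. With \<open>P\<close> and \<open>Q\<close> the
  acyclic orientations of \<open>G\<close> that extend by \<open>(u, w)\<close> and by \<open>(w, u)\<close>, the formula is
  \<open>\<bar>P\<bar> + \<bar>Q\<bar> = \<bar>P \<union> Q\<bar> + \<bar>P \<inter> Q\<bar>\<close>.\<close>

theorem deletion_contraction:
  assumes G: "simple_graph G" and uw: "u \<in> vertices G" "w \<in> vertices G" "u \<noteq> w"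
    and new: "{u, w} \<notin> edges G"
    and G': "simple_graph G'" and edges: "edges G' = (`) f ` edges G"
    and eq: "f u = f w"
    and fibre: "\<And>x y. x \<in> vertices G \<Longrightarrow> y \<in> vertices G \<Longrightarrow> f x = f y \<Longrightarrow>
      x = y \<or> x \<in> {u, w} \<and> y \<in> {u, w}"
  shows "num_acyclic_orientations (add_edge G {u, w}) =
    num_acyclic_orientations G + num_acyclic_orientations G'"
proof -
  define A where "A = {D. orientation G D \<and> acyclic D}"
  define P where "P = {D \<in> A. (w, u) \<notin> D\<^sup>+}"
  define Q where "Q = {D \<in> A. (u, w) \<notin> D\<^sup>+}"
  have fin: "finite P" "finite Q"
    by (rule finite_subset[OF _ finite_orientations[OF G]]; auto simp: A_def P_def Q_def)+
  have not_mem: "(u, w) \<notin> D" "(w, u) \<notin> D" if "D \<in> A" for D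
    using that new orientation_arcD[of G D] unfolding A_def by (metis insert_commute mem_Collect_eq)+

  have acyclic_ext: "acyclic (insert (x, y) D) \<longleftrightarrow> acyclic D \<and> (y, x) \<notin> D\<^sup>+"
    if "x \<noteq> y" for x y and D :: "'a rel"
    using that by (auto simp: rtrancl_eq_or_trancl)
  have "{D. orientation (add_edge G {u, w}) D \<and> acyclic D} =
      insert (u, w) ` P \<union> insert (w, u) ` Q" (is "?L = ?R")
  proof
    show "?L \<subseteq> ?R"
    proof clarify
      fix D assume "orientation (add_edge G {u, w}) D" and ac: "acyclic D" and
        not: "D \<notin> insert (w, u) ` Q"
      then obtain D0 where D0: "orientation G D0" and
        "D = insert (u, w) D0 \<or> D = insert (w, u) D0"
        using orientation_add_edge_iff[OF new] by blast
      then consider "D = insert (u, w) D0" | "D = insert (w, u) D0" by blast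
      then show "D \<in> insert (u, w) ` P"
      proof cases
        case 1
        then have "D0 \<in> P" using D0 ac acyclic_ext[OF uw(3)] by (simp add: A_def P_def)
        then show ?thesis using 1 by blast
      next
        case 2
        then have "D0 \<in> Q" using D0 ac acyclic_ext[OF uw(3)[symmetric]] by (simp add: A_def Q_def)
        then show ?thesis using 2 not by blast
      qed
    qed
    show "?R \<subseteq> ?L"
    proof
      fix D assume "D \<in> ?R"
      then consider D0 where "D0 \<in> P" "D = insert (u, w) D0"
        | D0 where "D0 \<in> Q" "D = insert (w, u) D0" by blast
      then show "D \<in> ?L"
      proof cases
        case 1
        then show ?thesis
          using acyclic_ext[OF uw(3)] orientation_add_edge_iff[OF new, of D]
          unfolding P_def A_def by blast
      next
        case 2
        then show ?thesis
          using acyclic_ext[OF uw(3)[symmetric]] orientation_add_edge_iff[OF new, of D]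
          unfolding Q_def A_def by blast
      qed
    qed
  qed
  moreover have "insert (u, w) ` P \<inter> insert (w, u) ` Q = {}"
  proof -
    have "insert (u, w) D1 \<noteq> insert (w, u) D2" if "D1 \<in> P" "D2 \<in> Q" for D1 D2
    proof -
      have "(u, w) \<notin> insert (w, u) D2"
        using that not_mem(1)[of D2] uw(3) by (simp add: Q_def)
      then show ?thesis by blast
    qed
    then show ?thesis by blast
  qed
  moreover have "inj_on (insert (u, w)) P" "inj_on (insert (w, u)) Q"
    using not_mem by (auto simp: inj_on_def P_def Q_def insert_ident)
  ultimately have "num_acyclic_orientations (add_edge G {u, w}) = card P + card Q"
    using fin by (simp add: num_acyclic_orientations_def card_Un_disjoint card_image)
  also have "\<dots> = card (P \<union> Q) + card (P \<inter> Q)"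
    using fin by (rule card_Un_Int)
  \<comment> \<open>Paths between \<open>u\<close> and \<open>w\<close> in both directions would form a cycle.\<close>
  also have "P \<union> Q = A"
    by (auto simp: A_def P_def Q_def acyclic_def dest: trancl_trans)
  also have "P \<inter> Q = {D. orientation G D \<and> acyclic (map_prod f f ` D)}"
  proof -
    have "acyclic (map_prod f f ` D) \<longleftrightarrow> acyclic D \<and> (u, w) \<notin> D\<^sup>+ \<and> (w, u) \<notin> D\<^sup>+"
      if "orientation G D" for D
      using orientation_subset_vertices[OF G that] eq fibre by (rule acyclic_identify_iff)
    then show ?thesis unfolding A_def P_def Q_def by blast
  qed
  also have "card \<dots> = num_acyclic_orientations G'"
    unfolding num_acyclic_orientations_def
    by (rule bij_betw_same_card[OF bij_betw_map_orientation[OF G G' edges]])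
  finally show ?thesis by (simp add: A_def num_acyclic_orientations_def)
qed

section \<open>Contractions of complete bipartite graphs\<close>

lemma edges_complete_bipartite_on:
  "edges (complete_multipartite_on [A, B]) = {{x, y} | x y. x \<in> A \<and> y \<in> B}"
proof -
  have index: "i = 0 \<and> j = 1 \<or> i = 1 \<and> j = 0"
    if "i < length [A, B]" "j < length [A, B]" "i \<noteq> j" for i j
    using that by auto
  show ?thesis
  proof
    show "edges (complete_multipartite_on [A, B]) \<subseteq> {{x, y} | x y. x \<in> A \<and> y \<in> B}"
    proof
      fix e assume "e \<in> edges (complete_multipartite_on [A, B])"
      then obtain x y i j where e: "e = {x, y}" and ij: "i < length [A, B]" "j < length [A, B]" "i \<noteq> j"
        and xy: "x \<in> [A, B] ! i" "y \<in> [A, B] ! j"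
        unfolding complete_multipartite_on_def ugraph.simps by blast
      have "x \<in> A \<and> y \<in> B \<or> y \<in> A \<and> x \<in> B" using index[OF ij] xy by auto
      moreover have "e = {y, x}" using e by (simp add: insert_commute)
      ultimately show "e \<in> {{x, y} | x y. x \<in> A \<and> y \<in> B}" using e by blast
    qed
    show "{{x, y} | x y. x \<in> A \<and> y \<in> B} \<subseteq> edges (complete_multipartite_on [A, B])"
    proof clarify
      fix x y assume "x \<in> A" "y \<in> B"
      then show "{x, y} \<in> edges (complete_multipartite_on [A, B])"
        unfolding complete_multipartite_on_def ugraph.simps
        by (intro CollectI exI[of _ x] exI[of _ y] exI[of _ 0] exI[of _ 1]) simp
    qed
  qed
qed

lemma edge_complete_bipartite_on_iff:
  "{x, y} \<in> edges (complete_multipartite_on [A, B]) \<longleftrightarrow> x \<in> A \<and> y \<in> B \<or> y \<in> A \<and> x \<in> B"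
  unfolding edges_complete_bipartite_on mem_Collect_eq doubleton_eq_iff by blast

lemma simple_graph_complete_bipartite_on:
  assumes "finite A" "finite B" "A \<inter> B = {}"
  shows "simple_graph (complete_multipartite_on [A, B])"
proof (rule simple_graph_complete_multipartite_on)
  show "finite V" if "V \<in> set [A, B]" for V using that assms by auto
  show "[A, B] ! i \<inter> [A, B] ! j = {}"
    if "i < length [A, B]" "j < length [A, B]" "i \<noteq> j" for i j
    using that assms by (auto simp: less_Suc_eq)
qed

lemma vertices_complete_bipartite_on:
  "vertices (complete_multipartite_on [A, B]) = A \<union> B"
  by (simp add: complete_multipartite_on_def)

lemma simple_graph_delete_edge:
  "simple_graph G \<Longrightarrow> simple_graph (delete_edge G e)"
  by (simp add: simple_graph_def delete_edge_def)

lemma edges_complete_multipartite: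
  "edges (complete_multipartite ms) =
    {{p, q} | p q. fst p < length ms \<and> snd p < ms ! fst p \<and>
       fst q < length ms \<and> snd q < ms ! fst q \<and> fst p \<noteq> fst q}"
  (is "_ = ?E")
proof
  show "edges (complete_multipartite ms) \<subseteq> ?E"
    by (force simp: complete_multipartite_def complete_multipartite_on_def)
  show "?E \<subseteq> edges (complete_multipartite ms)"
  proof clarify
    fix i k j l
    assume "fst (i, k) < length ms" "snd (i, k) < ms ! fst (i, k)" "fst (j, l) < length ms"
      "snd (j, l) < ms ! fst (j, l)" "fst (i, k) \<noteq> fst (j, l)"
    then show "{(i, k), (j, l)} \<in> edges (complete_multipartite ms)"
      unfolding complete_multipartite_def complete_multipartite_on_def ugraph.simps
      by (intro CollectI exI[of _ "(i, k)"] exI[of _ "(j, l)"] exI[of _ i] exI[of _ j]) simp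
  qed
qed

text \<open>Contracting \<open>u\<close> and \<open>w\<close> sends \<open>{u, y}\<close> and \<open>{w, y}\<close> to the same edge, and \<open>{w, y}\<close> is
  always present, so the contraction does not depend on which edges at \<open>u\<close> belong to \<open>G\<close>. Taking \<open>G\<close>
  to be \<open>K\<close> or \<open>K\<close> without one edge at \<open>u\<close> gives the first two identities.\<close>

lemma deletion_contraction_same_part:
  fixes A B :: "'a set"
  assumes fin: "finite A" "finite B" and disj: "A \<inter> B = {}"
    and uw: "u \<in> A" "w \<in> A" "u \<noteq> w"
    and G: "simple_graph G" "vertices G = A \<union> B"
    and E: "edges G \<subseteq> edges (complete_multipartite_on [A, B])"
    and large: "\<And>x y. x \<in> A - {u} \<Longrightarrow> y \<in> B \<Longrightarrow> {x, y} \<in> edges G"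
  shows "num_acyclic_orientations (add_edge G {u, w}) = num_acyclic_orientations G +
    num_acyclic_orientations (complete_multipartite [card A - 1, card B])"
proof -
  obtain g where g: "bij_betw g (A - {u}) {..<card A - 1}"
    using ex_bij_betw_finite_nat[of "A - {u}"] fin uw by (auto simp: atLeast0LessThan)
  obtain h where h: "bij_betw h B {..<card B}"
    using ex_bij_betw_finite_nat[of B] fin by (auto simp: atLeast0LessThan)
  define f :: "'a \<Rightarrow> nat \<times> nat" where
    "f x = (if x \<in> B then (1, h x) else (0, g (if x = u then w else x)))" for x
  have fA: "f x = (0, g (if x = u then w else x))" if "x \<in> A" for x
    using that disj by (auto simp: f_def)
  have fB: "f x = (1, h x)" if "x \<in> B" for x
    using that by (simp add: f_def)
  have g_lt: "g x < card A - 1" if "x \<in> A - {u}" for x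
    using bij_betwE[OF g] that by blast
  have h_lt: "h x < card B" if "x \<in> B" for x
    using bij_betwE[OF h] that by blast
  show ?thesis
  proof (rule deletion_contraction[where f = f])
    show "simple_graph G" "u \<noteq> w" "u \<in> vertices G" "w \<in> vertices G" using G uw by auto
    show "{u, w} \<notin> edges G"
      using E uw disj edge_complete_bipartite_on_iff[of u w A B] by blast
    show "simple_graph (complete_multipartite [card A - 1, card B])"
      by (rule simple_graph_complete_multipartite)
    show "f u = f w" using uw by (simp add: fA)
    show "x = y \<or> x \<in> {u, w} \<and> y \<in> {u, w}"
      if "x \<in> vertices G" "y \<in> vertices G" "f x = f y" for x y
    proof (cases "x \<in> B \<or> y \<in> B")
      case True
      then have "x \<in> B" "y \<in> B" "h x = h y"
        using that G(2) fA fB by fastforce+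
      then show ?thesis using inj_onD[OF bij_betw_imp_inj_on[OF h]] by blast
    next
      case False
      then have xy: "x \<in> A" "y \<in> A" using that G(2) by blast+
      let ?r = "\<lambda>x. if x = u then w else x"
      have "g (?r x) = g (?r y)" using that(3) fA[OF xy(1)] fA[OF xy(2)] by simp
      moreover have "?r x \<in> A - {u}" "?r y \<in> A - {u}" using xy uw by auto
      ultimately have "?r x = ?r y" by (rule inj_onD[OF bij_betw_imp_inj_on[OF g]])
      then show ?thesis by (auto split: if_splits)
    qed
    show "edges (complete_multipartite [card A - 1, card B]) = (`) f ` edges G"
    proof
      show "(`) f ` edges G \<subseteq> edges (complete_multipartite [card A - 1, card B])"
      proof clarify
        fix e assume "e \<in> edges G"
        then obtain x y where "e = {x, y}" "x \<in> A" "y \<in> B"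
          using E by (auto simp: edges_complete_bipartite_on)
        moreover from this have "fst (f x) = 0" "snd (f x) < card A - 1"
            "fst (f y) = 1" "snd (f y) < card B"
          using g_lt h_lt uw by (auto simp: fA fB)
        ultimately show "f ` e \<in> edges (complete_multipartite [card A - 1, card B])"
          unfolding edges_complete_multipartite
          by (intro CollectI exI[of _ "f x"] exI[of _ "f y"]) simp
      qed
      show "edges (complete_multipartite [card A - 1, card B]) \<subseteq> (`) f ` edges G"
      proof
        fix e assume "e \<in> edges (complete_multipartite [card A - 1, card B])"
        then obtain k l where e: "e = {(0, k), (1, l)}" and "k < card A - 1" "l < card B"
          by (fastforce simp: edges_complete_multipartite less_Suc_eq)
        then obtain x y where xy: "x \<in> A - {u}" "y \<in> B" "k = g x" "l = h y"
          using bij_betw_imp_surj_on[OF g] bij_betw_imp_surj_on[OF h] by blast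
        then have "e = f ` {x, y}" using e by (auto simp: fA fB)
        then show "e \<in> (`) f ` edges G" using large[OF xy(1,2)] by blast
      qed
    qed
  qed
qed

text \<open>The merged vertex inherits all of \<open>B - {v}\<close> as neighbours from \<open>u\<close> and all of \<open>A - {u}\<close>
  from \<open>v\<close>; it is the single vertex \<open>(2, 0)\<close> of the third part.\<close>

lemma deletion_contraction_bipartite_edge:
  fixes A B :: "'a set"
  assumes fin: "finite A" "finite B" and disj: "A \<inter> B = {}"
    and uv: "u \<in> A" "v \<in> B"
    and K: "K = complete_multipartite_on [A, B]"
  shows "num_acyclic_orientations K = num_acyclic_orientations (delete_edge K {u, v}) +
    num_acyclic_orientations (complete_multipartite [card A - 1, card B - 1, 1])"
proof -
  let ?M = "complete_multipartite [card A - 1, card B - 1, 1]"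
  let ?G = "delete_edge K {u, v}"
  obtain g where g: "bij_betw g (A - {u}) {..<card A - 1}"
    using ex_bij_betw_finite_nat[of "A - {u}"] fin uv by (auto simp: atLeast0LessThan)
  obtain h where h: "bij_betw h (B - {v}) {..<card B - 1}"
    using ex_bij_betw_finite_nat[of "B - {v}"] fin uv by (auto simp: atLeast0LessThan)
  define f :: "'a \<Rightarrow> nat \<times> nat" where
    "f x = (if x \<in> {u, v} then (2, 0) else if x \<in> A then (0, g x) else (1, h x))" for x
  have fuv: "f u = (2, 0)" "f v = (2, 0)" by (simp_all add: f_def)
  have fA: "f x = (0, g x)" if "x \<in> A - {u}" for x
    using that uv disj by (auto simp: f_def)
  have fB: "f x = (1, h x)" if "x \<in> B - {v}" for x
    using that uv disj by (auto simp: f_def)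
  have g_lt: "g x < card A - 1" if "x \<in> A - {u}" for x
    using bij_betwE[OF g] that by blast
  have h_lt: "h x < card B - 1" if "x \<in> B - {v}" for x
    using bij_betwE[OF h] that by blast
  have edges_G: "edges ?G = {{x, y} | x y. x \<in> A \<and> y \<in> B} - {{u, v}}"
    by (simp add: delete_edge_def K edges_complete_bipartite_on)
  have V: "vertices ?G = A \<union> B"
    by (simp add: delete_edge_def K vertices_complete_bipartite_on)
  have neq: "u \<noteq> v" using uv disj by blast
  have "add_edge ?G {u, v} = K"
    using uv by (simp add: add_edge_def delete_edge_def K edge_complete_bipartite_on_iff
        insert_absorb)
  moreover have "num_acyclic_orientations (add_edge ?G {u, v}) =
    num_acyclic_orientations ?G + num_acyclic_orientations ?M"
  proof (rule deletion_contraction[where f = f])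
    show "simple_graph ?G"
      unfolding K using fin disj
      by (intro simple_graph_delete_edge simple_graph_complete_bipartite_on)
    show "u \<noteq> v" "u \<in> vertices ?G" "v \<in> vertices ?G" using V uv neq by auto
    show "{u, v} \<notin> edges ?G" by (simp add: edges_G)
    show "simple_graph ?M" by (rule simple_graph_complete_multipartite)
    show "f u = f v" by (simp add: fuv)
    show "x = y \<or> x \<in> {u, v} \<and> y \<in> {u, v}"
      if "x \<in> vertices ?G" "y \<in> vertices ?G" "f x = f y" for x y
    proof -
      have "x \<in> {u, v} \<or> x \<in> A - {u} \<or> x \<in> B - {v}" "y \<in> {u, v} \<or> y \<in> A - {u} \<or> y \<in> B - {v}"
        using that V by auto
      then show ?thesis
        using that(3)
        by (elim disjE) (auto simp: fA fB fuv inj_on_eq_iff[OF bij_betw_imp_inj_on[OF g]]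
            inj_on_eq_iff[OF bij_betw_imp_inj_on[OF h]])
    qed
    show "edges ?M = (`) f ` edges ?G"
    proof
      show "(`) f ` edges ?G \<subseteq> edges ?M"
      proof clarify
        fix e assume "e \<in> edges ?G"
        then obtain x y where e: "e = {x, y}" and xy: "x \<in> A" "y \<in> B" "x \<noteq> u \<or> y \<noteq> v"
          by (auto simp: edges_G)
        have *: "fst (f x) = 0 \<and> snd (f x) < card A - 1 \<or> f x = (2, 0) \<and> x = u"
          "fst (f y) = 1 \<and> snd (f y) < card B - 1 \<or> f y = (2, 0) \<and> y = v"
          using g_lt h_lt fA fB fuv xy by fastforce+
        show "f ` e \<in> edges ?M"
          unfolding edges_complete_multipartite e
          by (intro CollectI exI[of _ "f x"] exI[of _ "f y"]) (use * xy(3) in auto)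
      qed
      show "edges ?M \<subseteq> (`) f ` edges ?G"
      proof
        fix e assume "e \<in> edges ?M"
        then consider
            (AB) k l where "e = {(0, k), (1, l)}" "k < card A - 1" "l < card B - 1"
          | (A) k where "e = {(0, k), (2, 0)}" "k < card A - 1"
          | (B) l where "e = {(2, 0), (1, l)}" "l < card B - 1"
          by (fastforce simp: edges_complete_multipartite less_Suc_eq numeral_2_eq_2)
        then show "e \<in> (`) f ` edges ?G"
        proof cases
          case AB
          then obtain x y where xy: "x \<in> A - {u}" "y \<in> B - {v}" "k = g x" "l = h y"
            using bij_betw_imp_surj_on[OF g] bij_betw_imp_surj_on[OF h] by blast
          then have "e = f ` {x, y}" using AB by (simp add: fA fB)
          moreover have "{x, y} \<in> edges ?G"
            using xy uv disj by (auto simp: edges_G doubleton_eq_iff)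
          ultimately show ?thesis by blast
        next
          case A
          then obtain x where x: "x \<in> A - {u}" "k = g x"
            using bij_betw_imp_surj_on[OF g] by blast
          then have "e = f ` {x, v}" using A by (simp add: fA fuv)
          moreover have "{x, v} \<in> edges ?G"
            using x uv disj by (auto simp: edges_G doubleton_eq_iff)
          ultimately show ?thesis by blast
        next
          case B
          then obtain y where y: "y \<in> B - {v}" "l = h y"
            using bij_betw_imp_surj_on[OF h] by blast
          then have "e = f ` {u, y}" using B by (simp add: fB fuv)
          moreover have "{u, y} \<in> edges ?G"
            using y uv disj by (auto simp: edges_G doubleton_eq_iff)
          ultimately show ?thesis by blast
        qed
      qed
    qed
  qed
  ultimately show ?thesis by simp
qed

theorem lemma4p3:
  fixes n\<^sub>1 n\<^sub>2 :: nat and V\<^sub>1 V\<^sub>2 :: "'a set" and K :: "'a ugraph"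
    and e e\<^sub>1 :: "'a set" and u w :: 'a
  assumes "n\<^sub>1 \<ge> 2" and "n\<^sub>2 \<ge> 1"
    and "finite V\<^sub>1" and "card V\<^sub>1 = n\<^sub>1"
    and "finite V\<^sub>2" and "card V\<^sub>2 = n\<^sub>2"
    and "V\<^sub>1 \<inter> V\<^sub>2 = {}"
    and "K = complete_multipartite_on [V\<^sub>1, V\<^sub>2]"
    and "e \<in> edges K" and "u \<in> e" and "u \<in> V\<^sub>1"
    and "w \<in> V\<^sub>1" and "w \<noteq> u" and "e\<^sub>1 = {u, w}"
  shows "num_acyclic_orientations (add_edge K e\<^sub>1) =
           num_acyclic_orientations K +
           num_acyclic_orientations (complete_multipartite [n\<^sub>1 - 1, n\<^sub>2])
       \<and> num_acyclic_orientations (delete_edge (add_edge K e\<^sub>1) e) =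
           num_acyclic_orientations (delete_edge K e) +
           num_acyclic_orientations (complete_multipartite [n\<^sub>1 - 1, n\<^sub>2])
       \<and> num_acyclic_orientations K =
           num_acyclic_orientations (delete_edge K e) +
           num_acyclic_orientations (complete_multipartite [n\<^sub>1 - 1, n\<^sub>2 - 1, 1])"
proof -
  have edges_K: "edges K = {{x, y} | x y. x \<in> V\<^sub>1 \<and> y \<in> V\<^sub>2}"
    unfolding assms(8) by (rule edges_complete_bipartite_on)
  have V: "vertices K = V\<^sub>1 \<union> V\<^sub>2" by (simp add: assms(8) vertices_complete_bipartite_on)
  have K: "simple_graph K"
    unfolding assms(8) using assms(3,5,7) by (rule simple_graph_complete_bipartite_on)
  obtain v where v: "v \<in> V\<^sub>2" "e = {u, v}"
    using assms(7,9,10,11) by (auto simp: edges_K)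
  have "e\<^sub>1 \<noteq> e" using assms(7,11,12,14) v by (auto simp: doubleton_eq_iff)
  then have swap: "delete_edge (add_edge K e\<^sub>1) e = add_edge (delete_edge K e) e\<^sub>1"
    by (simp add: add_edge_def delete_edge_def insert_Diff_if)
  note same_part = deletion_contraction_same_part[OF assms(3,5,7,11,12) assms(13)[symmetric],
      folded assms(14), unfolded assms(4,6)]
  have "num_acyclic_orientations (add_edge K e\<^sub>1) = num_acyclic_orientations K +
      num_acyclic_orientations (complete_multipartite [n\<^sub>1 - 1, n\<^sub>2])"
    by (rule same_part) (use K V assms(8) edges_K in auto)
  moreover have "num_acyclic_orientations (add_edge (delete_edge K e) e\<^sub>1) =
      num_acyclic_orientations (delete_edge K e) +
      num_acyclic_orientations (complete_multipartite [n\<^sub>1 - 1, n\<^sub>2])"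
  proof (rule same_part)
    show "simple_graph (delete_edge K e)" using K by (rule simple_graph_delete_edge)
    show "vertices (delete_edge K e) = V\<^sub>1 \<union> V\<^sub>2" by (simp add: delete_edge_def V)
    show "edges (delete_edge K e) \<subseteq> edges (complete_multipartite_on [V\<^sub>1, V\<^sub>2])"
      using assms(8) by (auto simp: delete_edge_def)
    show "{x, y} \<in> edges (delete_edge K e)" if "x \<in> V\<^sub>1 - {u}" "y \<in> V\<^sub>2" for x y
      using that v assms(7) by (auto simp: delete_edge_def edges_K doubleton_eq_iff)
  qed
  moreover have "num_acyclic_orientations K = num_acyclic_orientations (delete_edge K e) +
      num_acyclic_orientations (complete_multipartite [n\<^sub>1 - 1, n\<^sub>2 - 1, 1])"
    using deletion_contraction_bipartite_edge[OF assms(3,5,7,11) v(1) assms(8)]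
    by (simp only: v(2) assms(4,6))
  ultimately show ?thesis by (simp only: swap)
qed

end
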